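(* There is a universal constant $c>0$ such that the following holds. For any $n$ and even $k$, and small enough $\epsilon$, there exists an $(\epsilon,k)$-wise uniform distribution $\varphi$ over $\{-1,1\}^n$ which is $\delta$-far (in total variation distance) from every $k$-wise uniform distribution, where \[ \delta\ge \left(\frac{c}{k}\right)^k n^{k/2}\epsilon . \]
   Context: Distributions on $\{-1,1\}^n$ are identified with density functions $\varphi:\{-1,1\}^n\to\mathbb{R}^{\ge0}$ satisfying $\mathbb{E}_{x\sim\{-1,1\}^n}[\varphi(x)]=1$ (uniform expectation), with $\Pr[x]=\varphi(x)/2^n$. For $S\subseteq[n]$, $\widehat{\varphi}(S)=\mathbb{E}_{x\sim\{-1,1\}^n}[\varphi(x)\prod_{i\in S}x_i]$. $\varphi$ is $k$-wise uniform iff $\widehat\varphi(S)=0$ for all $1\le|S|\le k$, and $(\epsilon,k)$-wise uniform if $|\widehat\varphi(S)|\le\epsilon$ for all $1\le|S|\le k$. Total variation distance is $d_{TV}(\varphi,\psi)=\frac12\mathbb{E}_{x\sim\{-1,1\}^n}|\varphi(x)-\psi(x)|$, and $\varphi$ is $\delta$-far from $\psi$ if $d_{TV}(\varphi,\psi)>\delta$. *)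

theory Defs
  imports "HOL-Probability.Probability"
begin

text \<open>
  Points of the cube are extensional functions on \<open>{1..n}\<close>, so the dimension is an ordinary
  natural number and can be quantified inside a formula.
\<close>

definition cube :: "nat \<Rightarrow> (nat \<Rightarrow> real) set" where
  "cube n = {1..n} \<rightarrow>\<^sub>E {-1, 1}"

definition cube_expectation :: "nat \<Rightarrow> ((nat \<Rightarrow> real) \<Rightarrow> real) \<Rightarrow> real" where
  "cube_expectation n f = measure_pmf.expectation (pmf_of_set (cube n)) f"

text \<open>
  All notions below depend on a function only through its values on \<open>cube n\<close>;
  values outside the cube are irrelevant.
\<close>

definition cube_density :: "nat \<Rightarrow> ((nat \<Rightarrow> real) \<Rightarrow> real) \<Rightarrow> bool" where
  "cube_density n \<phi> \<longleftrightarrow> (\<forall>x\<in>cube n. 0 \<le> \<phi> x) \<and> cube_expectation n \<phi> = 1"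

definition fourier_coeff :: "nat \<Rightarrow> ((nat \<Rightarrow> real) \<Rightarrow> real) \<Rightarrow> nat set \<Rightarrow> real" where
  "fourier_coeff n \<phi> S = cube_expectation n (\<lambda>x. \<phi> x * (\<Prod>i\<in>S. x i))"

definition kwise_uniform :: "nat \<Rightarrow> nat \<Rightarrow> ((nat \<Rightarrow> real) \<Rightarrow> real) \<Rightarrow> bool" where
  "kwise_uniform n k \<phi> \<longleftrightarrow>
     (\<forall>S \<subseteq> {1..n}. 1 \<le> card S \<and> card S \<le> k \<longrightarrow> fourier_coeff n \<phi> S = 0)"

definition eps_kwise_uniform :: "nat \<Rightarrow> real \<Rightarrow> nat \<Rightarrow> ((nat \<Rightarrow> real) \<Rightarrow> real) \<Rightarrow> bool" where
  "eps_kwise_uniform n \<epsilon> k \<phi> \<longleftrightarrow>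
     (\<forall>S \<subseteq> {1..n}. 1 \<le> card S \<and> card S \<le> k \<longrightarrow> \<bar>fourier_coeff n \<phi> S\<bar> \<le> \<epsilon>)"

definition tv_dist :: "nat \<Rightarrow> ((nat \<Rightarrow> real) \<Rightarrow> real) \<Rightarrow> ((nat \<Rightarrow> real) \<Rightarrow> real) \<Rightarrow> real" where
  "tv_dist n \<phi> \<psi> = 1 / 2 * cube_expectation n (\<lambda>x. \<bar>\<phi> x - \<psi> x\<bar>)"

definition far_from ::
    "nat \<Rightarrow> real \<Rightarrow> ((nat \<Rightarrow> real) \<Rightarrow> real) \<Rightarrow> ((nat \<Rightarrow> real) \<Rightarrow> real) \<Rightarrow> bool" where
  "far_from n \<delta> \<phi> \<psi> \<longleftrightarrow> tv_dist n \<phi> \<psi> > \<delta>"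

lemma finite_cube [simp]: "finite (cube n)"
  unfolding cube_def by (intro finite_PiE) auto

lemma card_cube: "card (cube n) = 2 ^ n"
  unfolding cube_def by (simp add: card_PiE numeral_2_eq_2)

lemma cube_nonempty [simp]: "cube n \<noteq> {}"
  using card_cube[of n] by auto

lemma cube_expectation_eq: "cube_expectation n f = (\<Sum>x\<in>cube n. f x) / 2 ^ n"
  unfolding cube_expectation_def by (simp add: integral_pmf_of_set card_cube)

end

theory Submission imports Defs begin

text \<open>
  A density \<open>\<phi>\<close> is chosen whose nonempty Fourier coefficients up to level \<open>k\<close> are all of
  order \<open>\<epsilon>\<close> and whose support lies in the slab where \<open>\<bar>\<Sum>i. x i\<bar> \<le> 8 k sqrt n\<close>. It is tested against
  \<open>g x = (1 + (\<Sum>i. x i)) ^ k\<close>, which has degree \<open>k\<close> and nonnegative Fourier coefficients.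
  Replacing a \<open>k\<close>-wise uniform density by \<open>\<phi>\<close> increases the expectation of \<open>g\<close> by a multiple of
  \<open>\<epsilon> n ^ k\<close>. Since \<open>k\<close> is even, \<open>g \<ge> 0\<close>, so this increase is at most the total variation
  distance times the maximum of \<open>g\<close> on the support of \<open>\<phi>\<close>, that is \<open>O(k sqrt n) ^ k\<close>.

  By convex duality, \<open>\<phi>\<close> exists unless some polynomial of degree at most \<open>k\<close> is positive on the slab
  although its mean under a nearly uniform density is not. Hypercontractivity excludes
  this: such a polynomial has a \<open>3 ^ (- k)\<close> fraction of its \<open>L2\<close> norm in \<open>L1\<close>, too much to be
  compensated on the exponentially small complement of the slab.
\<close>

subsection \<open>Expectations over the cube\<close>

lemma cube_expectation_mono:
  assumes "\<And>x. x \<in> cube n \<Longrightarrow> f x \<le> g x"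
  shows "cube_expectation n f \<le> cube_expectation n g"
  unfolding cube_expectation_eq by (intro divide_right_mono sum_mono assms) auto

lemma cube_expectation_cong:
  assumes "\<And>x. x \<in> cube n \<Longrightarrow> f x = g x"
  shows "cube_expectation n f = cube_expectation n g"
  unfolding cube_expectation_eq using assms by simp

lemma cube_expectation_add:
  "cube_expectation n (\<lambda>x. f x + g x) = cube_expectation n f + cube_expectation n g"
  unfolding cube_expectation_eq by (simp add: sum.distrib add_divide_distrib)

lemma cube_expectation_diff:
  "cube_expectation n (\<lambda>x. f x - g x) = cube_expectation n f - cube_expectation n g"
  unfolding cube_expectation_eq by (simp add: sum_subtractf diff_divide_distrib)

lemma cube_expectation_cmult:
  "cube_expectation n (\<lambda>x. a * f x) = a * cube_expectation n f"
  unfolding cube_expectation_eq by (simp add: sum_distrib_left)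

lemma cube_expectation_const [simp]: "cube_expectation n (\<lambda>x. a) = a"
  unfolding cube_expectation_eq by (simp add: card_cube)

lemma cube_expectation_sum:
  "cube_expectation n (\<lambda>x. \<Sum>i\<in>I. f i x) = (\<Sum>i\<in>I. cube_expectation n (f i))"
  unfolding cube_expectation_eq by (subst sum.swap) (simp add: sum_divide_distrib)

lemma cube_expectation_nonneg:
  assumes "\<And>x. x \<in> cube n \<Longrightarrow> 0 \<le> f x"
  shows "0 \<le> cube_expectation n f"
  using cube_expectation_mono[of n "\<lambda>_. 0" f] assms by simp

lemma cube_expectation_eq_0_iff:
  assumes "\<And>x. x \<in> cube n \<Longrightarrow> 0 \<le> f x"
  shows "cube_expectation n f = 0 \<longleftrightarrow> (\<forall>x\<in>cube n. f x = 0)"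
  unfolding cube_expectation_eq using assms by (simp add: sum_nonneg_eq_0_iff)

lemma cube_expectation_Cauchy_Schwarz:
  "(cube_expectation n (\<lambda>x. f x * g x))\<^sup>2
     \<le> cube_expectation n (\<lambda>x. (f x)\<^sup>2) * cube_expectation n (\<lambda>x. (g x)\<^sup>2)"
  unfolding cube_expectation_eq power_divide times_divide_times_eq power2_eq_square[of "2 ^ n"]
  by (intro divide_right_mono Cauchy_Schwarz_ineq_sum) auto

lemma cube_expectation_0: "cube_expectation 0 f = f (\<lambda>_. undefined)"
  unfolding cube_expectation_eq by (simp add: cube_def)

text \<open>Conditioning on the last coordinate; every induction on the dimension goes through this
  identity.\<close>

lemma cube_expectation_Suc:
  "cube_expectation (Suc n) f
     = (cube_expectation n (\<lambda>x. f (x(Suc n := 1))) + cube_expectation n (\<lambda>x. f (x(Suc n := - 1)))) / 2"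
proof -
  have ins: "{1..Suc n} = insert (Suc n) {1..n}" by auto
  have "cube (Suc n) = (\<lambda>(y, g). g(Suc n := y)) ` ({- 1, 1} \<times> cube n)"
    unfolding cube_def ins by (subst PiE_insert_eq) simp
  moreover have "inj_on (\<lambda>(y, g). g(Suc n := y)) ({- 1, 1} \<times> cube n)"
    unfolding cube_def by (rule inj_combinator) simp
  ultimately have "(\<Sum>x\<in>cube (Suc n). f x) = (\<Sum>(y, g)\<in>{- 1, 1} \<times> cube n. f (g(Suc n := y)))"
    by (simp add: sum.reindex case_prod_unfold o_def)
  also have "\<dots> = (\<Sum>y\<in>{- 1, 1}. \<Sum>g\<in>cube n. f (g(Suc n := y)))"
    by (simp add: sum.cartesian_product)
  finally show ?thesis
    unfolding cube_expectation_eq by (simp add: field_simps)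
qed

lemma cube_coord: "x \<in> cube n \<Longrightarrow> i \<in> {1..n} \<Longrightarrow> x i = - 1 \<or> x i = 1"
  unfolding cube_def by (auto simp: PiE_def Pi_def)

subsection \<open>Characters and multilinear polynomials\<close>

lemma abs_character:
  assumes "x \<in> cube n" "S \<subseteq> {1..n}"
  shows "\<bar>\<Prod>i\<in>S. x i\<bar> = 1"
proof -
  have "\<bar>x i\<bar> = 1" if "i \<in> S" for i
  proof -
    have "i \<in> {1..n}" using that assms(2) by blast
    then show ?thesis using cube_coord[OF assms(1), of i] by auto
  qed
  then show ?thesis by (simp add: abs_prod)
qed

text \<open>Coordinates common to \<open>S\<close> and \<open>R\<close> occur squared, and the
  square of a sign is 1.\<close>

lemma character_mult:
  assumes "x \<in> cube n" "S \<subseteq> {1..n}" "R \<subseteq> {1..n}"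
  shows "(\<Prod>i\<in>S. x i) * (\<Prod>i\<in>R. x i) = (\<Prod>i\<in>sym_diff S R. x i)"
proof -
  have fin: "finite S" "finite R"
    using assms finite_subset by blast+
  have S: "(\<Prod>i\<in>S. x i) = (\<Prod>i\<in>S - R. x i) * (\<Prod>i\<in>S \<inter> R. x i)"
    using fin by (subst prod.union_disjoint[symmetric]) (auto intro: arg_cong2[where f = prod])
  have R: "(\<Prod>i\<in>R. x i) = (\<Prod>i\<in>R - S. x i) * (\<Prod>i\<in>S \<inter> R. x i)"
    using fin by (subst prod.union_disjoint[symmetric]) (auto intro: arg_cong2[where f = prod])
  have "(\<Prod>i\<in>S \<inter> R. x i) * (\<Prod>i\<in>S \<inter> R. x i) = 1"
    using abs_character[OF assms(1), of "S \<inter> R"] assms(2) abs_mult_self_eq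
    by (metis le_infI1 mult_1)
  moreover have "(\<Prod>i\<in>sym_diff S R. x i) = (\<Prod>i\<in>S - R. x i) * (\<Prod>i\<in>R - S. x i)"
    using fin by (intro prod.union_disjoint) auto
  ultimately show ?thesis
    unfolding S R by (simp add: mult_ac)
qed

lemma expectation_character:
  assumes "S \<subseteq> {1..n}" "S \<noteq> {}"
  shows "cube_expectation n (\<lambda>x. \<Prod>i\<in>S. x i) = 0"
  using assms
proof (induction n arbitrary: S)
  case 0
  then show ?case by simp
next
  case (Suc n)
  have fin: "finite S" using Suc.prems finite_subset by blast
  show ?case
  proof (cases "Suc n \<in> S")
    case True
    have "(\<Prod>i\<in>S. (x(Suc n := y)) i) = y * (\<Prod>i\<in>S - {Suc n}. x i)" for x and y :: real
      using fin True by (simp add: prod.remove[of S "Suc n"])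
    then show ?thesis
      by (simp add: cube_expectation_Suc cube_expectation_cmult[of n "- 1", simplified])
  next
    case False
    then have "S \<subseteq> {1..n}"
      using Suc.prems by (metis atLeastAtMostSuc_conv le_add1 plus_1_eq_Suc subset_insert)
    moreover have "(\<Prod>i\<in>S. (x(Suc n := y)) i) = (\<Prod>i\<in>S. x i)" for x and y :: real
      using False by (intro prod.cong) auto
    ultimately show ?thesis
      using Suc by (simp add: cube_expectation_Suc)
  qed
qed

lemma fourier_coeff_character:
  assumes "S \<subseteq> {1..n}" "R \<subseteq> {1..n}"
  shows "cube_expectation n (\<lambda>x. (\<Prod>i\<in>S. x i) * (\<Prod>i\<in>R. x i)) = (if S = R then 1 else 0)"
proof -
  have "cube_expectation n (\<lambda>x. (\<Prod>i\<in>S. x i) * (\<Prod>i\<in>R. x i))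
      = cube_expectation n (\<lambda>x. \<Prod>i\<in>sym_diff S R. x i)"
    using character_mult assms by (intro cube_expectation_cong) blast
  also have "\<dots> = (if S = R then 1 else 0)"
  proof (cases "S = R")
    case False
    then have "sym_diff S R \<noteq> {}" by auto
    then show ?thesis
      using expectation_character[of "sym_diff S R" n] assms False by auto
  qed simp
  finally show ?thesis .
qed

text \<open>A Fourier expansion given by its coefficients. Degree at most \<open>d\<close> is
  expressed by \<open>w\<close> vanishing on sets of more than \<open>d\<close> elements; only the
  values of \<open>w\<close> on subsets of \<open>{1..n}\<close> matter.\<close>

definition multilinear :: "nat \<Rightarrow> (nat set \<Rightarrow> real) \<Rightarrow> (nat \<Rightarrow> real) \<Rightarrow> real" where
  "multilinear n w x = (\<Sum>S\<in>Pow {1..n}. w S * (\<Prod>i\<in>S. x i))"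

text \<open>The split into \<open>g + y * h\<close> with \<open>g\<close> and \<open>h\<close> free
  of the last coordinate. The part \<open>h\<close> has lost one degree, which drives the induction
  in \<open>Bonami\<close>.\<close>

lemma multilinear_Suc:
  "multilinear (Suc n) w (x(Suc n := y))
     = multilinear n w x + y * multilinear n (\<lambda>S. w (insert (Suc n) S)) x"
proof -
  have ins: "{1..Suc n} = insert (Suc n) {1..n}" by auto
  have old: "(\<Prod>i\<in>S. (x(Suc n := y)) i) = (\<Prod>i\<in>S. x i)" if "S \<in> Pow {1..n}" for S
    using that by (intro prod.cong) auto
  have new: "(\<Prod>i\<in>insert (Suc n) S. (x(Suc n := y)) i) = y * (\<Prod>i\<in>S. x i)"
    if "S \<in> Pow {1..n}" for S
  proof -
    have "Suc n \<notin> S" "finite S"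
      using that finite_subset[of S "{1..n}"] by auto
    with old[OF that] show ?thesis by simp
  qed
  have "inj_on (insert (Suc n)) (Pow {1..n})"
    by (rule inj_onI) (metis Pow_iff atLeastAtMost_iff insert_ident not_less_eq_eq order_refl subsetD)
  moreover have "Pow {1..n} \<inter> insert (Suc n) ` Pow {1..n} = {}"
    by auto
  ultimately have "multilinear (Suc n) w (x(Suc n := y))
      = (\<Sum>S\<in>Pow {1..n}. w S * (\<Prod>i\<in>S. (x(Suc n := y)) i))
      + (\<Sum>S\<in>Pow {1..n}. w (insert (Suc n) S) * (\<Prod>i\<in>insert (Suc n) S. (x(Suc n := y)) i))"
    unfolding multilinear_def ins Pow_insert
    by (simp add: sum.union_disjoint sum.reindex o_def del: fun_upd_apply)
  also have "\<dots> = multilinear n w x + y * multilinear n (\<lambda>S. w (insert (Suc n) S)) x"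
    unfolding multilinear_def sum_distrib_left
    by (intro arg_cong2[where f = "(+)"] sum.cong) (simp_all only: old new mult_ac)
  finally show ?thesis .
qed

subsection \<open>Hypercontractivity\<close>

text \<open>The (4,2) hypercontractive inequality. In \<open>g + y * h\<close>, averaging over the
  sign \<open>y\<close> kills the odd powers of \<open>y\<close>. Cauchy-Schwarz controls the mixed
  term, and the lower degree of \<open>h\<close> pays for its coefficient 6.\<close>

lemma Bonami:
  assumes "\<And>S. S \<subseteq> {1..n} \<Longrightarrow> d < card S \<Longrightarrow> w S = 0"
  shows "cube_expectation n (\<lambda>x. (multilinear n w x) ^ 4)
           \<le> 9 ^ d * (cube_expectation n (\<lambda>x. (multilinear n w x)\<^sup>2))\<^sup>2"
  using assms
proof (induction n arbitrary: d w)
  case 0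
  have "m ^ 4 \<le> 9 ^ d * m ^ 4" for m :: real
    by (simp add: mult_le_cancel_right1)
  then show ?case by (simp add: cube_expectation_0 flip: power_mult)
next
  case (Suc n)
  define g where "g = multilinear n w"
  define h where "h = multilinear n (\<lambda>S. w (insert (Suc n) S))"
  let ?E = "cube_expectation n"
  define G where "G = ?E (\<lambda>x. (g x)\<^sup>2)"
  define H where "H = ?E (\<lambda>x. (h x)\<^sup>2)"
  have G0: "0 \<le> G" and H0: "0 \<le> H"
    unfolding G_def H_def by (auto intro: cube_expectation_nonneg)
  have E2: "cube_expectation (Suc n) (\<lambda>x. (multilinear (Suc n) w x)\<^sup>2) = G + H"
  proof -
    have "(?E (\<lambda>x. (g x + h x)\<^sup>2) + ?E (\<lambda>x. (g x - h x)\<^sup>2)) = ?E (\<lambda>x. 2 * ((g x)\<^sup>2 + (h x)\<^sup>2))"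
      unfolding cube_expectation_add[symmetric]
      by (intro cube_expectation_cong) (simp add: power2_eq_square algebra_simps)
    then show ?thesis
      unfolding cube_expectation_Suc multilinear_Suc G_def H_def g_def[symmetric] h_def[symmetric]
      by (simp add: cube_expectation_add cube_expectation_cmult)
  qed
  have E4: "cube_expectation (Suc n) (\<lambda>x. (multilinear (Suc n) w x) ^ 4)
      = ?E (\<lambda>x. (g x) ^ 4) + 6 * ?E (\<lambda>x. (g x)\<^sup>2 * (h x)\<^sup>2) + ?E (\<lambda>x. (h x) ^ 4)"
  proof -
    have "(?E (\<lambda>x. (g x + h x) ^ 4) + ?E (\<lambda>x. (g x - h x) ^ 4))
        = ?E (\<lambda>x. 2 * ((g x) ^ 4 + 6 * ((g x)\<^sup>2 * (h x)\<^sup>2) + (h x) ^ 4))"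
      unfolding cube_expectation_add[symmetric]
      by (intro cube_expectation_cong) (simp add: power2_eq_square power4_eq_xxxx algebra_simps)
    then show ?thesis
      unfolding cube_expectation_Suc multilinear_Suc g_def[symmetric] h_def[symmetric]
      by (simp add: cube_expectation_add cube_expectation_cmult)
  qed
  have g4: "?E (\<lambda>x. (g x) ^ 4) \<le> 9 ^ d * G\<^sup>2"
    unfolding g_def G_def by (intro Suc.IH Suc.prems) auto
  \<comment> \<open>The factor 9 records the lower degree of \<open>h\<close>. Kept on the left, it
    also covers \<open>d = 0\<close>, where \<open>h\<close> vanishes and degree
    \<open>d - 1\<close> would make no sense.\<close>
  have h4: "9 * ?E (\<lambda>x. (h x) ^ 4) \<le> 9 ^ d * H\<^sup>2"
  proof (cases d)
    case 0
    have "w (insert (Suc n) S) = 0" if "S \<subseteq> {1..n}" for S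
    proof (rule Suc.prems)
      show "insert (Suc n) S \<subseteq> {1..Suc n}" using that by auto
      show "d < card (insert (Suc n) S)"
        using that finite_subset[of S "{1..n}"] by (simp add: 0 card_gt_0_iff)
    qed
    then have "h x = 0" for x
      unfolding h_def multilinear_def by (intro sum.neutral) auto
    then show ?thesis by simp
  next
    case (Suc e)
    have "?E (\<lambda>x. (h x) ^ 4) \<le> 9 ^ e * H\<^sup>2"
      unfolding h_def H_def
    proof (rule Suc.IH)
      fix S assume S: "S \<subseteq> {1..n}" "e < card S"
      then have "Suc n \<notin> S" "finite S" using finite_subset[of S "{1..n}"] by auto
      then show "w (insert (Suc n) S) = 0"
        using S by (intro Suc.prems) (auto simp: \<open>d = Suc e\<close>)
    qed
    then show ?thesis using Suc by simp
  qed
  \<comment> \<open>The spare 9 from \<open>h4\<close> becomes a 3 under the square root, so the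
    mixed term is at most \<open>9 ^ d * 2 * G * H\<close>, the cross term of
    \<open>9 ^ d * (G + H)\<^sup>2\<close>.\<close>
  have "(3 * ?E (\<lambda>x. (g x)\<^sup>2 * (h x)\<^sup>2))\<^sup>2 \<le> 9 * (?E (\<lambda>x. (g x) ^ 4) * ?E (\<lambda>x. (h x) ^ 4))"
    using cube_expectation_Cauchy_Schwarz[of n "\<lambda>x. (g x)\<^sup>2" "\<lambda>x. (h x)\<^sup>2"]
    by (simp add: power_mult_distrib flip: power_mult)
  also have "\<dots> = ?E (\<lambda>x. (g x) ^ 4) * (9 * ?E (\<lambda>x. (h x) ^ 4))" by simp
  also have "\<dots> \<le> (9 ^ d * G\<^sup>2) * (9 ^ d * H\<^sup>2)"
    by (intro mult_mono g4 h4) (auto intro!: cube_expectation_nonneg mult_nonneg_nonneg)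
  also have "\<dots> = (9 ^ d * G * H)\<^sup>2" by (simp add: power2_eq_square)
  finally have "3 * ?E (\<lambda>x. (g x)\<^sup>2 * (h x)\<^sup>2) \<le> 9 ^ d * G * H"
    using G0 H0 by (meson power2_le_imp_le mult_nonneg_nonneg zero_le_numeral zero_le_power)
  moreover have "?E (\<lambda>x. (h x) ^ 4) \<ge> 0" by (intro cube_expectation_nonneg) simp
  ultimately show ?case
    unfolding E2 E4 using g4 h4 by (simp add: power2_eq_square algebra_simps)
qed

text \<open>A controlled fourth moment keeps the square mass from sitting on rare large values.
  Averaging \<open>v\<^sup>2 - v ^ 4 / 4 \<le> v\<close> at \<open>v = \<bar>p x\<bar> / r\<close>
  turns \<open>Bonami\<close> into a lower bound on the first moment.\<close>

lemma L2_le_L1: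
  assumes deg: "\<And>S. S \<subseteq> {1..n} \<Longrightarrow> d < card S \<Longrightarrow> w S = 0"
  shows "3 / 4 * sqrt (cube_expectation n (\<lambda>x. (multilinear n w x)\<^sup>2))
           \<le> 3 ^ d * cube_expectation n (\<lambda>x. \<bar>multilinear n w x\<bar>)"
proof -
  let ?E = "cube_expectation n" and ?p = "multilinear n w"
  define m where "m = sqrt (?E (\<lambda>x. (?p x)\<^sup>2))"
  have m0: "0 \<le> m" unfolding m_def by (auto intro: cube_expectation_nonneg)
  have m2: "?E (\<lambda>x. (?p x)\<^sup>2) = m\<^sup>2"
    unfolding m_def by (simp add: cube_expectation_nonneg)
  \<comment> \<open>With this scale \<open>r\<^sup>2\<close> cancels the constant
    \<open>9 ^ d\<close> of \<open>Bonami\<close>: the quartic term costs only a quarter of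
    \<open>m\<^sup>2\<close>, whence the 3/4.\<close>
  define r where "r = 3 ^ d * m"
  show ?thesis
  proof (cases "m = 0")
    case True
    then show ?thesis unfolding m_def[symmetric] by (simp add: cube_expectation_nonneg)
  next
    case False
    then have r: "0 < r" and m: "0 < m" unfolding r_def using m0 by auto
    have quartic: "v\<^sup>2 - v ^ 4 / 4 \<le> v" if "0 \<le> v" for v :: real
    proof -
      \<comment> \<open>A certificate that \<open>v ^ 3 / 4 - v + 1\<close> is positive for
        nonnegative \<open>v\<close>; 6/5 is a rational value near its minimizer 2/sqrt 3.\<close>
      have "0 \<le> v * ((5 * v - 6)\<^sup>2 * (5 * v + 12) + 40 * v + 68)" using that by simp
      also have "\<dots> = 500 * (v - v\<^sup>2 + v ^ 4 / 4)"
        by (simp add: power2_eq_square power4_eq_xxxx algebra_simps)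
      finally show ?thesis by simp
    qed
    have "(?p x)\<^sup>2 - (?p x) ^ 4 / (4 * r\<^sup>2) \<le> r * \<bar>?p x\<bar>" for x
    proof -
      have "r\<^sup>2 * ((\<bar>?p x\<bar> / r)\<^sup>2 - (\<bar>?p x\<bar> / r) ^ 4 / 4) \<le> r\<^sup>2 * (\<bar>?p x\<bar> / r)"
        using r by (intro mult_left_mono quartic) auto
      moreover have "r\<^sup>2 * ((\<bar>?p x\<bar> / r)\<^sup>2 - (\<bar>?p x\<bar> / r) ^ 4 / 4) = (?p x)\<^sup>2 - (?p x) ^ 4 / (4 * r\<^sup>2)"
        using r by (simp add: power_divide right_diff_distrib) (simp add: field_simps power2_eq_square power4_eq_xxxx)
      moreover have "r\<^sup>2 * (\<bar>?p x\<bar> / r) = r * \<bar>?p x\<bar>"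
        using r by (simp add: power2_eq_square)
      ultimately show ?thesis by simp
    qed
    then have "?E (\<lambda>x. (?p x)\<^sup>2 - 1 / (4 * r\<^sup>2) * (?p x) ^ 4) \<le> ?E (\<lambda>x. r * \<bar>?p x\<bar>)"
      by (intro cube_expectation_mono) simp
    then have "m\<^sup>2 - 1 / (4 * r\<^sup>2) * ?E (\<lambda>x. (?p x) ^ 4) \<le> r * ?E (\<lambda>x. \<bar>?p x\<bar>)"
      by (simp only: cube_expectation_diff cube_expectation_cmult m2)
    moreover have "1 / (4 * r\<^sup>2) * ?E (\<lambda>x. (?p x) ^ 4) \<le> 1 / (4 * r\<^sup>2) * (9 ^ d * (m\<^sup>2)\<^sup>2)"
      using Bonami[of n d w] deg m2 by (intro mult_left_mono) auto
    moreover have "1 / (4 * r\<^sup>2) * (9 ^ d * (m\<^sup>2)\<^sup>2) = m\<^sup>2 / 4"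
    proof -
      have "r\<^sup>2 = 9 ^ d * m\<^sup>2"
        unfolding r_def by (simp add: power_mult_distrib power2_eq_square flip: power_mult_distrib)
      then show ?thesis using m by (simp add: power2_eq_square)
    qed
    ultimately have "m * (3 / 4 * m) \<le> m * (3 ^ d * ?E (\<lambda>x. \<bar>?p x\<bar>))"
      unfolding r_def by (simp add: power2_eq_square algebra_simps)
    then show ?thesis using m unfolding m_def[symmetric] by simp
  qed
qed

subsection \<open>Tail bound\<close>

lemma sum_fun_upd_Suc:
  fixes x :: "nat \<Rightarrow> real"
  shows "(\<Sum>i=1..Suc n. (x(Suc n := y)) i) = (\<Sum>i=1..n. x i) + y"
proof -
  have "(\<Sum>i=1..n. (x(Suc n := y)) i) = (\<Sum>i=1..n. x i)"
    by (intro sum.cong) auto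
  then show ?thesis by simp
qed

text \<open>The symmetrised moment generating function of the sum. The shift \<open>a\<close>
  absorbs the last coordinate in the induction.\<close>

lemma expectation_cosh:
  "cube_expectation n (\<lambda>x. cosh (a + l * (\<Sum>i=1..n. x i))) = cosh a * cosh l ^ n"
proof (induction n arbitrary: a)
  case 0
  then show ?case by (simp add: cube_expectation_0)
next
  case (Suc n)
  have "cosh (a + l) + cosh (a - l) = 2 * cosh a * cosh l"
    by (simp add: cosh_add cosh_diff)
  moreover have "a + l * (s + 1) = (a + l) + l * s" "a + l * (s + - 1) = (a - l) + l * s" for s
    by (simp_all add: algebra_simps)
  ultimately show ?case
    unfolding cube_expectation_Suc sum_fun_upd_Suc
    by (simp only: Suc.IH flip: distrib_right) simp
qed

lemma expectation_square_shifted_sum: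
  "cube_expectation n (\<lambda>x. (a + (\<Sum>i=1..n. x i))\<^sup>2) = a\<^sup>2 + real n"
proof (induction n arbitrary: a)
  case 0
  then show ?case by (simp add: cube_expectation_0)
next
  case (Suc n)
  have "a + (s + 1) = (a + 1) + s" "a + (s + - 1) = (a - 1) + s" for s
    by simp_all
  then show ?case
    unfolding cube_expectation_Suc sum_fun_upd_Suc
    by (simp only: Suc.IH) (simp add: power2_eq_square algebra_simps)
qed

lemma cosh_le_exp_square:
  fixes l :: real
  assumes "0 \<le> l" "l \<le> 1"
  shows "cosh l \<le> exp (l\<^sup>2)"
proof -
  have "exp (- l) \<le> 1 - l + l\<^sup>2"
  proof -
    \<comment> \<open>Multiplying by \<open>1 + l \<le> exp l\<close> reduces the bound to the
      factorization of \<open>1 + l ^ 3\<close>.\<close>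
    have "1 = exp l * exp (- l)" by (simp flip: exp_add)
    also have "\<dots> \<ge> (1 + l) * exp (- l)"
      by (intro mult_right_mono exp_ge_add_one_self) simp
    finally have "(1 + l) * exp (- l) \<le> 1 + l ^ 3" using assms(1) by (smt (verit) zero_le_power)
    also have "\<dots> = (1 + l) * (1 - l + l\<^sup>2)"
      by (simp add: power2_eq_square power3_eq_cube algebra_simps)
    finally show ?thesis using assms(1) by simp
  qed
  then have "cosh l \<le> 1 + l\<^sup>2"
    using exp_bound[OF assms] by (simp add: cosh_field_def)
  also have "\<dots> \<le> exp (l\<^sup>2)" by (rule exp_ge_add_one_self)
  finally show ?thesis .
qed

text \<open>Chernoff's method with \<open>cosh\<close> in place of \<open>exp\<close>, so that both
  tails are treated at once. The 8 in the threshold makes the decay rate 256, well above the 9 lost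
  to hypercontractivity.\<close>

lemma cube_sum_tail:
  assumes n: "1 \<le> n"
  shows "cube_expectation n (\<lambda>x. if \<bar>\<Sum>i=1..n. x i\<bar> \<le> 8 * real k * sqrt n then 0 else 1)
           \<le> 6 / 256 ^ k"
proof -
  \<comment> \<open>This choice turns the threshold into \<open>8 * real k\<close> and bounds
    \<open>cosh l ^ n\<close> by \<open>exp 1\<close>.\<close>
  define l where "l = 1 / sqrt n"
  have l: "0 < l" "l \<le> 1" "l\<^sup>2 * n = 1" "l * sqrt n = 1"
    using n unfolding l_def by (auto simp: power_divide)
  have "exp (8 * real k) \<ge> 256 ^ k"
  proof -
    have "(256::real) ^ k = (2 ^ 8) ^ k" by simp
    also have "\<dots> \<le> (exp 1 ^ 8) ^ k"
      using exp_ge_add_one_self[of 1] by (intro power_mono) auto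
    also have "\<dots> = exp (8 * real k)"
      by (simp add: mult.commute flip: exp_of_nat_mult power_mult)
    finally show ?thesis .
  qed
  then have k: "256 ^ k \<le> 2 * cosh (8 * real k)"
    using exp_gt_zero[of "- (8 * real k)"] unfolding cosh_field_def by (simp add: field_simps del: exp_gt_zero)
  have "(if \<bar>\<Sum>i=1..n. x i\<bar> \<le> 8 * real k * sqrt n then 0 else 1)
      \<le> 2 / 256 ^ k * cosh (0 + l * (\<Sum>i=1..n. x i))" for x :: "nat \<Rightarrow> real"
  proof (cases "\<bar>\<Sum>i=1..n. x i\<bar> \<le> 8 * real k * sqrt n")
    case False
    have "8 * real k = l * (8 * real k * sqrt n)" using l by (simp add: mult_ac)
    also have "\<dots> \<le> l * \<bar>\<Sum>i=1..n. x i\<bar>" using False l by (intro mult_left_mono) auto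
    also have "\<dots> = \<bar>l * (\<Sum>i=1..n. x i)\<bar>" using l by (simp add: abs_mult)
    finally have "cosh (8 * real k) \<le> cosh \<bar>l * (\<Sum>i=1..n. x i)\<bar>"
      by (subst cosh_real_nonneg_le_iff) auto
    with k False show ?thesis by (simp add: field_simps)
  qed simp
  then have "cube_expectation n (\<lambda>x. if \<bar>\<Sum>i=1..n. x i\<bar> \<le> 8 * real k * sqrt n then 0 else 1)
      \<le> cube_expectation n (\<lambda>x. 2 / 256 ^ k * cosh (0 + l * (\<Sum>i=1..n. x i)))"
    by (intro cube_expectation_mono)
  also have "\<dots> = 2 / 256 ^ k * cosh l ^ n"
    unfolding cube_expectation_cmult expectation_cosh by simp
  also have "\<dots> \<le> 2 / 256 ^ k * exp (l\<^sup>2) ^ n"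
    using l by (intro mult_left_mono power_mono cosh_le_exp_square) auto
  also have "exp (l\<^sup>2) ^ n = exp 1"
    using l by (simp add: mult.commute flip: exp_of_nat_mult)
  also have "2 / 256 ^ k * exp 1 \<le> 2 / 256 ^ k * (3::real)"
    using exp_le by (intro mult_left_mono) auto
  finally show ?thesis by simp
qed

subsection \<open>Matching low-degree moments on a large set\<close>

text \<open>
  If no linear functional is positive on all points \<open>v x\<close>, then the origin lies in their convex
  hull. Moving from the current combination towards a point with nonpositive
  inner product with it (the Frank--Wolfe algorithm) yields the quantitative form below.
\<close>

lemma approximate_Gordan:
  fixes v :: "'a \<Rightarrow> 'i \<Rightarrow> real"
  assumes fin: "finite A"
    and alt: "\<And>w. \<exists>x\<in>A. (\<Sum>i\<in>I. w i * v x i) \<le> 0"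
    and B: "\<And>x. x \<in> A \<Longrightarrow> (\<Sum>i\<in>I. (v x i)\<^sup>2) \<le> B"
  shows "\<exists>a. (\<forall>x\<in>A. 0 \<le> a x) \<and> sum a A = 1 \<and>
           (\<Sum>i\<in>I. (\<Sum>x\<in>A. a x * v x i)\<^sup>2) \<le> B / real (Suc m)"
proof -
  have single: "(\<Sum>x\<in>A. (if x = y then 1 else 0) * f x) = f y" if "y \<in> A" for y and f :: "'a \<Rightarrow> real"
    using that fin by (simp add: if_distrib[of "\<lambda>z. z * _"] cong: if_cong)
  show ?thesis
  proof (induction m)
    case 0
    \<comment> \<open>Any functional will do: only nonemptiness of \<open>A\<close> is extracted
      here.\<close>
    obtain y where y: "y \<in> A" using alt[of undefined] by blast
    have "sum (\<lambda>x. if x = y then 1 else 0 :: real) A = 1" using y fin by simp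
    with y show ?case
      by (intro exI[of _ "\<lambda>x. if x = y then 1 else 0"]) (simp add: single B)
  next
    case (Suc m)
    then obtain a where a: "\<And>x. x \<in> A \<Longrightarrow> 0 \<le> a x" "sum a A = 1"
      "(\<Sum>i\<in>I. (\<Sum>x\<in>A. a x * v x i)\<^sup>2) \<le> B / real (Suc m)" by blast
    define u where "u i = (\<Sum>x\<in>A. a x * v x i)" for i
    obtain y where y: "y \<in> A" "(\<Sum>i\<in>I. u i * v y i) \<le> 0" using alt[of u] by blast
    \<comment> \<open>The step size for which \<open>(1 - t)\<^sup>2 / (m + 1) + t\<^sup>2\<close>
      equals \<open>1 / (m + 2)\<close>, so the bound reproduces itself.\<close>
    define t where "t = 1 / (real m + 2)"
    have t: "0 \<le> t" "0 \<le> 1 - t" unfolding t_def by (auto simp: field_simps)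
    define b where "b x = (1 - t) * a x + t * (if x = y then 1 else 0)" for x
    have b: "(\<Sum>x\<in>A. b x * f x) = (1 - t) * (\<Sum>x\<in>A. a x * f x) + t * f y" for f
      unfolding b_def distrib_right mult.assoc
      by (simp only: sum.distrib sum_distrib_left[symmetric] single[OF y(1)])
    have "(\<Sum>i\<in>I. (\<Sum>x\<in>A. b x * v x i)\<^sup>2)
        = (1 - t)\<^sup>2 * (\<Sum>i\<in>I. (u i)\<^sup>2) + 2 * t * (1 - t) * (\<Sum>i\<in>I. u i * v y i) + t\<^sup>2 * (\<Sum>i\<in>I. (v y i)\<^sup>2)"
      unfolding b u_def[symmetric]
      by (simp add: sum_distrib_left power2_eq_square algebra_simps flip: sum.distrib)
    also have "\<dots> \<le> (1 - t)\<^sup>2 * (B / real (Suc m)) + 0 + t\<^sup>2 * B"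
    proof (intro add_mono mult_left_mono)
      show "2 * t * (1 - t) * (\<Sum>i\<in>I. u i * v y i) \<le> 0"
        using t y by (intro mult_nonneg_nonpos) auto
    qed (use a(3) y(1) B in \<open>auto simp: u_def\<close>)
    also have "\<dots> = B / real (Suc (Suc m))"
    proof -
      have t1: "1 - t = (real m + 1) * t" unfolding t_def by (simp add: field_simps)
      have "(1 - t)\<^sup>2 * (B / real (Suc m)) = B * (real m + 1) * t\<^sup>2"
        unfolding t1 by (simp add: power2_eq_square add.commute)
      then have "(1 - t)\<^sup>2 * (B / real (Suc m)) + 0 + t\<^sup>2 * B = B * ((real m + 2) * t) * t"
        by (simp add: power2_eq_square algebra_simps)
      also have "\<dots> = B / real (Suc (Suc m))" unfolding t_def by simp
      finally show ?thesis .
    qed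
    finally have "(\<Sum>i\<in>I. (\<Sum>x\<in>A. b x * v x i)\<^sup>2) \<le> B / real (Suc (Suc m))" .
    moreover have "\<forall>x\<in>A. 0 \<le> b x" unfolding b_def using a(1) t by simp
    moreover have "sum b A = 1" using b[of "\<lambda>_. 1"] a(2) by simp
    ultimately show ?case by blast
  qed
qed

text \<open>If \<open>p\<close> were positive on all of \<open>A\<close>, its negative values would
  lie off \<open>A\<close>, where Cauchy-Schwarz makes the integral \<open>r\<close> of its absolute
  value less than a quarter of the lower bound from \<open>L2_le_L1\<close>. The
  \<open>q\<close>-mean would then be positive. The threshold on \<open>A\<close> is the square of
  \<open>3 / 16 / 3 ^ k\<close>.\<close>

lemma low_degree_nonpos_point:
  assumes deg: "\<And>S. S \<subseteq> {1..n} \<Longrightarrow> k < card S \<Longrightarrow> w S = 0"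
    and A: "cube_expectation n (\<lambda>x. if x \<in> A then 0 else 1) < 9 / 256 / 9 ^ k"
    and q: "\<And>x. x \<in> cube n \<Longrightarrow> 1 / 2 \<le> q x" "\<And>x. x \<in> cube n \<Longrightarrow> q x \<le> 3 / 2"
    and zero: "cube_expectation n (\<lambda>x. q x * multilinear n w x) \<le> 0"
  shows "\<exists>x\<in>A \<inter> cube n. multilinear n w x \<le> 0"
proof (rule ccontr)
  let ?E = "cube_expectation n"
  define p where "p = multilinear n w"
  define m where "m = sqrt (?E (\<lambda>x. (p x)\<^sup>2))"
  assume "\<not> ?thesis"
  then have pos: "p x > 0" if "x \<in> A" "x \<in> cube n" for x
    using that unfolding p_def by force
  have "(9::real) / 256 / 9 ^ k < 1"
    by (rule le_less_trans[of _ "9 / 256 / 1"]) (intro divide_left_mono one_le_power, auto)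
  have "A \<inter> cube n \<noteq> {}"
  proof
    assume "A \<inter> cube n = {}"
    then have "?E (\<lambda>x. if x \<in> A then 0 else 1) = ?E (\<lambda>x. 1)"
      by (intro cube_expectation_cong) auto
    with A \<open>9 / 256 / 9 ^ k < 1\<close> show False by simp
  qed
  have "m \<noteq> 0"
  proof
    assume "m = 0"
    then have "?E (\<lambda>x. (p x)\<^sup>2) = 0" unfolding m_def by simp
    then have "\<forall>x\<in>cube n. p x = 0" by (subst (asm) cube_expectation_eq_0_iff) auto
    with pos \<open>A \<inter> cube n \<noteq> {}\<close> show False by force
  qed
  moreover have "0 \<le> m" unfolding m_def by (simp add: cube_expectation_nonneg)
  ultimately have m: "0 < m" by simp
  have m2: "?E (\<lambda>x. (p x)\<^sup>2) = m\<^sup>2" unfolding m_def by (simp add: cube_expectation_nonneg)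
  have L1: "3 / 4 * m \<le> 3 ^ k * ?E (\<lambda>x. \<bar>p x\<bar>)"
    unfolding m_def p_def by (intro L2_le_L1 deg)
  define r where "r = ?E (\<lambda>x. \<bar>p x\<bar> * (if x \<in> A then 0 else 1))"
  have "r\<^sup>2 \<le> m\<^sup>2 * ?E (\<lambda>x. (if x \<in> A then 0 else 1)\<^sup>2)"
    unfolding r_def using cube_expectation_Cauchy_Schwarz[of n "\<lambda>x. \<bar>p x\<bar>" "\<lambda>x. if x \<in> A then 0 else 1"]
    by (simp add: m2)
  also have "?E (\<lambda>x. (if x \<in> A then 0 else 1)\<^sup>2) = ?E (\<lambda>x. if x \<in> A then 0 else 1)"
    by (intro cube_expectation_cong) simp
  also have "m\<^sup>2 * \<dots> < m\<^sup>2 * (9 / 256 / 9 ^ k)"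
    using A m by (intro mult_strict_left_mono) auto
  also have "\<dots> = (3 / 16 * m / 3 ^ k)\<^sup>2"
    by (simp add: power_divide power_mult_distrib flip: power_mult) (simp add: power_mult mult.commute[of k])
  finally have "r < 3 / 16 * m / 3 ^ k"
    using m by (intro power2_less_imp_less[of r]) auto
  then have "2 * r < 1 / 2 * (3 / 4 * m / 3 ^ k)" by simp
  also have "\<dots> \<le> 1 / 2 * ?E (\<lambda>x. \<bar>p x\<bar>)"
    using L1 by (simp add: field_simps)
  also have "\<dots> - 2 * r = ?E (\<lambda>x. 1 / 2 * \<bar>p x\<bar> - 2 * (\<bar>p x\<bar> * (if x \<in> A then 0 else 1)))"
    unfolding r_def by (simp only: cube_expectation_diff cube_expectation_cmult)
  also have "\<dots> \<le> ?E (\<lambda>x. q x * p x)"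
  proof (rule cube_expectation_mono)
    fix x assume x: "x \<in> cube n"
    \<comment> \<open>On \<open>A\<close> the lower bound on \<open>q\<close> suffices. Off
      \<open>A\<close> the worst value is \<open>- 3 / 2 * \<bar>p x\<bar>\<close>, and -3/2 = 1/2 -
      2.\<close>
    show "1 / 2 * \<bar>p x\<bar> - 2 * (\<bar>p x\<bar> * (if x \<in> A then 0 else 1)) \<le> q x * p x"
    proof (cases "x \<in> A")
      case True
      then show ?thesis using pos[OF True x] mult_right_mono[OF q(1)[OF x], of "p x"] by simp
    next
      case False
      have "\<bar>q x * p x\<bar> \<le> 3 / 2 * \<bar>p x\<bar>"
        unfolding abs_mult using q[OF x] by (intro mult_right_mono) auto
      with False show ?thesis by simp
    qed
  qed
  finally show False using zero unfolding p_def by simp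
qed

text \<open>\<open>approximate_Gordan\<close> is applied to the characters centred at the
  coefficients of \<open>q\<close>. A linear functional of these is a polynomial of degree at most
  \<open>k\<close> with \<open>q\<close>-mean zero, so it takes a nonpositive value on
  \<open>A\<close>; the resulting convex weights give \<open>\<phi>\<close>.\<close>

lemma density_matching_low_degree:
  assumes A: "cube_expectation n (\<lambda>x. if x \<in> A then 0 else 1) < 9 / 256 / 9 ^ k"
    and q: "\<And>x. x \<in> cube n \<Longrightarrow> 1 / 2 \<le> q x" "\<And>x. x \<in> cube n \<Longrightarrow> q x \<le> 3 / 2"
      "cube_expectation n q = 1"
    and \<eta>: "0 < \<eta>"
  shows "\<exists>\<phi>. cube_density n \<phi> \<and> (\<forall>x\<in>cube n. \<phi> x \<noteq> 0 \<longrightarrow> x \<in> A) \<and>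
    (\<forall>S\<subseteq>{1..n}. 1 \<le> card S \<and> card S \<le> k \<longrightarrow> \<bar>fourier_coeff n \<phi> S - fourier_coeff n q S\<bar> \<le> \<eta>)"
proof -
  let ?chi = "\<lambda>S x. \<Prod>i\<in>S. x i :: real"
  define I where "I = {S. S \<subseteq> {1..n} \<and> 1 \<le> card S \<and> card S \<le> k}"
  have I: "finite I" "I \<subseteq> Pow {1..n}" unfolding I_def
    by (auto intro: finite_subset[of _ "Pow {1..n}"])
  define v where "v x S = ?chi S x - fourier_coeff n q S" for x S
  let ?A = "A \<inter> cube n"
  have alt: "\<exists>x\<in>?A. (\<Sum>S\<in>I. w S * v x S) \<le> 0" for w
  proof -
    \<comment> \<open>The constant term is chosen to make the \<open>q\<close>-mean zero.\<close>
    define w' where "w' S = (if S \<in> I then w S else if S = {} then - (\<Sum>S\<in>I. w S * fourier_coeff n q S) else 0)" for S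
    have "{} \<notin> I" unfolding I_def by simp
    have p: "multilinear n w' x = (\<Sum>S\<in>I. w S * v x S)" for x
    proof -
      have "multilinear n w' x = (\<Sum>S\<in>insert {} I. w' S * ?chi S x)"
        unfolding multilinear_def
        by (rule sum.mono_neutral_right) (use I in \<open>auto simp: w'_def\<close>)
      also have "\<dots> = w' {} + (\<Sum>S\<in>I. w' S * ?chi S x)"
        using I \<open>{} \<notin> I\<close> by simp
      also have "\<dots> = (\<Sum>S\<in>I. w S * v x S)"
        using \<open>{} \<notin> I\<close> by (simp add: w'_def v_def algebra_simps sum_subtractf)
      finally show ?thesis .
    qed
    have "\<exists>x\<in>?A. multilinear n w' x \<le> 0"
    proof (rule low_degree_nonpos_point[OF _ A q(1,2)])
      fix S assume "S \<subseteq> {1..n}" "k < card S"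
      then show "w' S = 0" unfolding w'_def I_def by auto
    next
      have "cube_expectation n (\<lambda>x. q x * multilinear n w' x)
          = cube_expectation n (\<lambda>x. \<Sum>S\<in>I. w S * (q x * ?chi S x - fourier_coeff n q S * q x))"
        unfolding p v_def by (simp add: sum_distrib_left algebra_simps)
      also have "\<dots> = 0"
        unfolding cube_expectation_sum cube_expectation_cmult cube_expectation_diff q(3)
        by (simp add: fourier_coeff_def)
      finally show "cube_expectation n (\<lambda>x. q x * multilinear n w' x) \<le> 0" by simp
    qed auto
    then show ?thesis unfolding p .
  qed
  \<comment> \<open>A crude bound suffices, since the number of iterations \<open>m\<close> can be
    taken as large as \<open>B\<close> requires.\<close>
  define B where "B = (\<Sum>x\<in>?A. \<Sum>S\<in>I. (v x S)\<^sup>2)"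
  have fin: "finite ?A" by simp
  have B: "(\<Sum>S\<in>I. (v x S)\<^sup>2) \<le> B" if "x \<in> ?A" for x
    unfolding B_def using that by (intro member_le_sum) (auto intro: sum_nonneg)
  obtain m :: nat where "B / \<eta>\<^sup>2 \<le> real m" using real_arch_simple by blast
  then have m: "B / real (Suc m) \<le> \<eta>\<^sup>2" using \<eta> by (simp add: field_simps add_increasing)
  obtain a where a: "\<And>x. x \<in> ?A \<Longrightarrow> 0 \<le> a x" "sum a ?A = 1"
    "(\<Sum>S\<in>I. (\<Sum>x\<in>?A. a x * v x S)\<^sup>2) \<le> B / real (Suc m)"
    using approximate_Gordan[of ?A v I B m] alt B fin by blast
  \<comment> \<open>The factor \<open>2 ^ n\<close> converts probabilities into a density.\<close>
  define \<phi> where "\<phi> x = (if x \<in> A then 2 ^ n * a x else 0)" for x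
  have E: "cube_expectation n (\<lambda>x. \<phi> x * f x) = (\<Sum>x\<in>?A. a x * f x)" for f
  proof -
    have "(\<Sum>x\<in>cube n. \<phi> x * f x) = (\<Sum>x\<in>?A. \<phi> x * f x)"
      by (rule sum.mono_neutral_right) (auto simp: \<phi>_def)
    also have "\<dots> = (\<Sum>x\<in>?A. 2 ^ n * (a x * f x))"
      by (intro sum.cong) (auto simp: \<phi>_def)
    finally show ?thesis
      unfolding cube_expectation_eq by (simp flip: sum_distrib_left)
  qed
  have "cube_expectation n \<phi> = 1"
    using E[of "\<lambda>_. 1"] a(2) by simp
  then have "cube_density n \<phi>"
    unfolding cube_density_def using a(1) by (simp add: \<phi>_def)
  moreover have "\<bar>fourier_coeff n \<phi> S - fourier_coeff n q S\<bar> \<le> \<eta>" if "S \<in> I" for S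
  proof -
    have "(\<Sum>x\<in>?A. a x * v x S) = fourier_coeff n \<phi> S - sum a ?A * fourier_coeff n q S"
      unfolding fourier_coeff_def[of n \<phi>] E v_def
      by (simp add: algebra_simps sum_subtractf sum_distrib_left)
    then have "(fourier_coeff n \<phi> S - fourier_coeff n q S)\<^sup>2 = (\<Sum>x\<in>?A. a x * v x S)\<^sup>2"
      by (simp add: a(2))
    also have "\<dots> \<le> (\<Sum>S\<in>I. (\<Sum>x\<in>?A. a x * v x S)\<^sup>2)"
      using that I(1) by (intro member_le_sum) auto
    also have "\<dots> \<le> \<eta>\<^sup>2" using a(3) m by linarith
    finally show ?thesis using \<eta> by (simp add: abs_le_square_iff[symmetric])
  qed
  ultimately show ?thesis
    by (intro exI[of _ \<phi>]) (auto simp: I_def \<phi>_def)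
qed

subsection \<open>The test function\<close>

text \<open>Multiplication by a coordinate permutes the characters by the involution that toggles
  \<open>i\<close>.\<close>

lemma multilinear_times_coord:
  assumes "x \<in> cube n" "i \<in> {1..n}"
  shows "x i * multilinear n w x = multilinear n (\<lambda>S. w (sym_diff S {i})) x"
proof -
  have "x i * multilinear n w x = (\<Sum>S\<in>Pow {1..n}. w S * (\<Prod>j\<in>sym_diff S {i}. x j))"
    unfolding multilinear_def sum_distrib_left
  proof (rule sum.cong)
    fix S assume "S \<in> Pow {1..n}"
    then show "x i * (w S * (\<Prod>j\<in>S. x j)) = w S * (\<Prod>j\<in>sym_diff S {i}. x j)"
      using character_mult[OF assms(1), of S "{i}"] assms(2) by (simp add: mult_ac)
  qed simp
  also have "\<dots> = (\<Sum>S\<in>Pow {1..n}. w (sym_diff S {i}) * (\<Prod>j\<in>S. x j))"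
    by (rule sum.reindex_bij_witness[of _ "\<lambda>S. sym_diff S {i}" "\<lambda>S. sym_diff S {i}"])
      (use assms(2) in \<open>auto intro!: arg_cong2[where f = "(*)"] arg_cong[where f = w] prod.cong\<close>)
  finally show ?thesis unfolding multilinear_def .
qed

text \<open>Each further factor adds toggled copies of the coefficients, which keeps them
  nonnegative and raises the degree by at most one. The summand 1 matters for \<open>n = 1\<close>,
  where an even power of the bare sum is constant on the cube.\<close>

lemma power_shifted_sum_multilinear:
  "\<exists>w. (\<forall>S. 0 \<le> w S) \<and> (\<forall>S\<subseteq>{1..n}. d < card S \<longrightarrow> w S = 0) \<and>
     (\<forall>x\<in>cube n. (1 + (\<Sum>i=1..n. x i)) ^ d = multilinear n w x)"
proof (induction d)
  case 0
  have "(\<Sum>S\<in>Pow {1..n}. (if S = {} then 1 else 0) * (\<Prod>i\<in>S. x i)) = 1" for x :: "nat \<Rightarrow> real"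
    by (simp add: if_distrib[of "\<lambda>z. z * _"] cong: if_cong)
  then show ?case
    by (intro exI[of _ "\<lambda>S. if S = {} then 1 else 0"]) (auto simp: multilinear_def)
next
  case (Suc d)
  then obtain w where w: "\<And>S. 0 \<le> w S" "\<And>S. S \<subseteq> {1..n} \<Longrightarrow> d < card S \<Longrightarrow> w S = 0"
    "\<And>x. x \<in> cube n \<Longrightarrow> (1 + (\<Sum>i=1..n. x i)) ^ d = multilinear n w x" by blast
  define w' where "w' S = w S + (\<Sum>i=1..n. w (sym_diff S {i}))" for S
  have "0 \<le> w' S" for S unfolding w'_def using w(1) by (simp add: sum_nonneg)
  moreover have "w' S = 0" if S: "S \<subseteq> {1..n}" "Suc d < card S" for S
  proof -
    have "w (sym_diff S {i}) = 0" if "i \<in> {1..n}" for i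
    proof (rule w(2))
      have fin: "finite S" using S finite_subset by blast
      have "card S - 1 \<le> card (S - {i})"
        using diff_card_le_card_Diff[of "{i}" S] by simp
      also have "\<dots> \<le> card (sym_diff S {i})" using fin by (intro card_mono) auto
      finally show "d < card (sym_diff S {i})" using S by simp
    qed (use S that in auto)
    then show ?thesis unfolding w'_def using w(2) S by simp
  qed
  moreover have "(1 + (\<Sum>i=1..n. x i)) ^ Suc d = multilinear n w' x" if x: "x \<in> cube n" for x
  proof -
    have "(1 + (\<Sum>i=1..n. x i)) ^ Suc d
        = multilinear n w x + (\<Sum>i=1..n. x i * multilinear n w x)"
      using w(3)[OF x] by (simp add: distrib_right sum_distrib_right)
    also have "\<dots> = multilinear n w x + (\<Sum>i=1..n. multilinear n (\<lambda>S. w (sym_diff S {i})) x)"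
      using multilinear_times_coord[OF x] by simp
    also have "\<dots> = multilinear n w' x"
      unfolding multilinear_def w'_def distrib_right sum.distrib sum_distrib_right
      by (subst sum.swap) simp
    finally show ?thesis .
  qed
  ultimately show ?case by blast
qed

lemma expectation_times_multilinear:
  "cube_expectation n (\<lambda>x. \<phi> x * multilinear n w x) = (\<Sum>S\<in>Pow {1..n}. w S * fourier_coeff n \<phi> S)"
proof -
  have "\<phi> x * multilinear n w x = (\<Sum>S\<in>Pow {1..n}. w S * (\<phi> x * (\<Prod>i\<in>S. x i)))" for x
    unfolding multilinear_def sum_distrib_left by (simp add: mult_ac)
  then show ?thesis
    by (simp only: cube_expectation_sum cube_expectation_cmult fourier_coeff_def)
qed

lemma fourier_coeff_empty: "cube_density n \<phi> \<Longrightarrow> fourier_coeff n \<phi> {} = 1"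
  by (simp add: cube_density_def fourier_coeff_def)

lemma abs_cube_sum_le:
  assumes "x \<in> cube n"
  shows "\<bar>\<Sum>i=1..n. x i\<bar> \<le> real n"
proof -
  have "\<bar>\<Sum>i=1..n. x i\<bar> \<le> (\<Sum>i=1..n. \<bar>x i\<bar>)" by (rule sum_abs)
  also have "\<dots> \<le> (\<Sum>i=1..n. 1)"
    using cube_coord[OF assms] by (intro sum_mono) force
  finally show ?thesis by simp
qed

text \<open>By Plancherel the gap is the sum of \<open>w S\<close> times the difference of
  coefficients. The empty set cancels, levels 1 to \<open>k\<close> gain at least
  \<open>\<gamma>\<close>, and \<open>w\<close> vanishes above \<open>k\<close>. It remains to see
  that \<open>w {}\<close> carries at most half of the total weight.\<close>

lemma expectation_gap:
  assumes \<phi>: "cube_density n \<phi>" and \<psi>: "cube_density n \<psi>" "kwise_uniform n k \<psi>"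
    and n: "1 \<le> n" and k: "2 \<le> k" "even k"
    and coeff: "\<And>S. S \<subseteq> {1..n} \<Longrightarrow> 1 \<le> card S \<Longrightarrow> card S \<le> k \<Longrightarrow> \<gamma> \<le> fourier_coeff n \<phi> S"
    and \<gamma>: "0 \<le> \<gamma>"
  shows "\<gamma> * real n ^ k / 2 \<le> cube_expectation n (\<lambda>x. (\<phi> x - \<psi> x) * (1 + (\<Sum>i=1..n. x i)) ^ k)"
proof -
  obtain w where w: "\<And>S. 0 \<le> w S" "\<And>S. S \<subseteq> {1..n} \<Longrightarrow> k < card S \<Longrightarrow> w S = 0"
    "\<And>x. x \<in> cube n \<Longrightarrow> (1 + (\<Sum>i=1..n. x i)) ^ k = multilinear n w x"
    using power_shifted_sum_multilinear[of n k] by blast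
  have uniform: "fourier_coeff n (\<lambda>_. 1) S = (if S = {} then 1 else 0)" if "S \<subseteq> {1..n}" for S
    using expectation_character[OF that] by (simp add: fourier_coeff_def)
  have w0: "w {} = cube_expectation n (\<lambda>x. (1 + (\<Sum>i=1..n. x i)) ^ k)"
  proof -
    have "cube_expectation n (\<lambda>x. (1 + (\<Sum>i=1..n. x i)) ^ k)
        = (\<Sum>S\<in>Pow {1..n}. w S * fourier_coeff n (\<lambda>_. 1) S)"
      unfolding expectation_times_multilinear[symmetric]
      by (intro cube_expectation_cong) (simp only: w(3) mult_1_left)
    also have "\<dots> = (\<Sum>S\<in>Pow {1..n}. w S * (if S = {} then 1 else 0))"
      by (intro sum.cong) (auto simp: uniform)
    also have "\<dots> = w {}"
      by (simp add: if_distrib[of "\<lambda>z. _ * z"] cong: if_cong)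
    finally show ?thesis by simp
  qed
  have "w {} \<le> cube_expectation n (\<lambda>x. (real n + 1) ^ (k - 2) * (1 + (\<Sum>i=1..n. x i))\<^sup>2)"
    unfolding w0
  proof (rule cube_expectation_mono)
    fix x assume "x \<in> cube n"
    define s where "s = 1 + (\<Sum>i=1..n. x i)"
    \<comment> \<open>All but two factors are bounded by \<open>n + 1\<close>; the remaining square
      has mean \<open>n + 1\<close>, which saves one factor.\<close>
    have "s ^ k = \<bar>s\<bar> ^ (k - 2 + 2)"
      using k by (simp only: power_even_abs le_add_diff_inverse2)
    also have "\<dots> = \<bar>s\<bar> ^ (k - 2) * s\<^sup>2" by (simp only: power_add power2_abs)
    also have "\<dots> \<le> (real n + 1) ^ (k - 2) * s\<^sup>2"
      using abs_cube_sum_le[OF \<open>x \<in> cube n\<close>] unfolding s_def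
      by (intro mult_right_mono power_mono) auto
    finally show "(1 + (\<Sum>i=1..n. x i)) ^ k \<le> (real n + 1) ^ (k - 2) * (1 + (\<Sum>i=1..n. x i))\<^sup>2"
      unfolding s_def .
  qed
  also have "\<dots> = (real n + 1) ^ (k - 2) * (real n + 1)"
    unfolding cube_expectation_cmult expectation_square_shifted_sum by simp
  also have "\<dots> = (real n + 1) ^ k / (real n + 1)"
  proof -
    have "(real n + 1) ^ k = (real n + 1) ^ (k - 2 + 2)" using k(1) by (simp only: le_add_diff_inverse2)
    also have "\<dots> = (real n + 1) ^ (k - 2) * (real n + 1) * (real n + 1)"
      by (simp only: power_add power2_eq_square mult.assoc)
    finally show ?thesis by simp
  qed
  also have "\<dots> \<le> (real n + 1) ^ k / 2"
    using n by (intro divide_left_mono) auto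
  finally have w0_le: "w {} \<le> (real n + 1) ^ k / 2" .
  have total: "(\<Sum>S\<in>Pow {1..n}. w S) = (real n + 1) ^ k"
  proof -
    \<comment> \<open>At the all-ones point every character is 1, so the polynomial evaluates to the
      sum of its coefficients.\<close>
    define e where "e = (\<lambda>i\<in>{1..n}. 1 :: real)"
    have "e \<in> cube n" unfolding cube_def e_def by auto
    moreover have "(\<Prod>i\<in>S. e i) = 1" if "S \<in> Pow {1..n}" for S
      using that by (intro prod.neutral) (auto simp: e_def)
    ultimately show ?thesis
      using w(3)[of e] by (simp add: multilinear_def e_def add.commute)
  qed
  have "\<gamma> * real n ^ k / 2 \<le> \<gamma> * ((real n + 1) ^ k - w {})"
  proof -
    have "real n ^ k \<le> (real n + 1) ^ k" by (intro power_mono) auto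
    with w0_le have "real n ^ k / 2 \<le> (real n + 1) ^ k - w {}" by simp
    from mult_left_mono[OF this \<gamma>] show ?thesis by simp
  qed
  also have "\<dots> = (\<Sum>S\<in>Pow {1..n} - {{}}. w S * \<gamma>)"
    by (simp add: sum_diff1 flip: sum_distrib_right total)
  also have "\<dots> \<le> (\<Sum>S\<in>Pow {1..n} - {{}}. w S * (fourier_coeff n \<phi> S - fourier_coeff n \<psi> S))"
  proof (rule sum_mono)
    fix S assume S: "S \<in> Pow {1..n} - {{}}"
    then have "finite S" using finite_subset by blast
    with S have S': "S \<subseteq> {1..n}" "1 \<le> card S" by (auto simp: Suc_le_eq card_gt_0_iff)
    show "w S * \<gamma> \<le> w S * (fourier_coeff n \<phi> S - fourier_coeff n \<psi> S)"
    proof (cases "card S \<le> k")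
      case True
      then have "fourier_coeff n \<psi> S = 0" using \<psi>(2) S' unfolding kwise_uniform_def by blast
      then show ?thesis using coeff[OF S' True] w(1) by (intro mult_left_mono) auto
    next
      case False
      then show ?thesis using w(2) S' by simp
    qed
  qed
  also have "\<dots> = (\<Sum>S\<in>Pow {1..n}. w S * (fourier_coeff n \<phi> S - fourier_coeff n \<psi> S))"
    using fourier_coeff_empty[OF \<phi>] fourier_coeff_empty[OF \<psi>(1)] by (simp add: sum_diff1)
  also have "\<dots> = cube_expectation n (\<lambda>x. (\<phi> x - \<psi> x) * multilinear n w x)"
    unfolding expectation_times_multilinear
    by (simp add: fourier_coeff_def left_diff_distrib cube_expectation_diff)
  also have "\<dots> = cube_expectation n (\<lambda>x. (\<phi> x - \<psi> x) * (1 + (\<Sum>i=1..n. x i)) ^ k)"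
    by (intro cube_expectation_cong) (simp only: w(3) mult_1_left)
  finally show ?thesis .
qed

text \<open>
  Only the mass that \<open>\<psi>\<close> removes from \<open>\<phi>\<close> can make the difference positive, so \<open>g\<close> need be bounded
  above only on the support of \<open>\<phi>\<close>.
\<close>

lemma expectation_gap_le_tv_dist:
  assumes \<phi>: "cube_density n \<phi>" and \<psi>: "cube_density n \<psi>"
    and g: "\<And>x. x \<in> cube n \<Longrightarrow> 0 \<le> g x" "\<And>x. x \<in> cube n \<Longrightarrow> \<phi> x \<noteq> 0 \<Longrightarrow> g x \<le> M"
    and M: "0 \<le> M"
  shows "cube_expectation n (\<lambda>x. (\<phi> x - \<psi> x) * g x) \<le> M * tv_dist n \<phi> \<psi>"
proof -
  \<comment> \<open>The right side is \<open>M\<close> times the positive part of the difference;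
    its linear term has mean zero because both are densities.\<close>
  have "(\<phi> x - \<psi> x) * g x \<le> M / 2 * (\<bar>\<phi> x - \<psi> x\<bar> + (\<phi> x - \<psi> x))" if x: "x \<in> cube n" for x
  proof (cases "\<phi> x \<le> \<psi> x")
    case True
    then show ?thesis using g(1)[OF x] by (simp add: mult_nonpos_nonneg)
  next
    case False
    moreover have "0 \<le> \<psi> x" using \<psi> x unfolding cube_density_def by blast
    ultimately have "(\<phi> x - \<psi> x) * g x \<le> (\<phi> x - \<psi> x) * M"
      using g(2)[OF x] by (intro mult_left_mono) auto
    with False show ?thesis by (simp add: algebra_simps)
  qed
  then have "cube_expectation n (\<lambda>x. (\<phi> x - \<psi> x) * g x)
      \<le> cube_expectation n (\<lambda>x. M / 2 * (\<bar>\<phi> x - \<psi> x\<bar> + (\<phi> x - \<psi> x)))"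
    by (rule cube_expectation_mono)
  also have "\<dots> = M * tv_dist n \<phi> \<psi>"
    using \<phi> \<psi> unfolding cube_expectation_cmult cube_expectation_add tv_dist_def cube_density_def
    by (simp add: cube_expectation_diff)
  finally show ?thesis .
qed

section \<open>Choice of the density and the final estimate\<close>

text \<open>The target \<open>q\<close> has all nonempty coefficients equal to
  \<open>\<epsilon> / 2\<close>; the bound \<open>1 / 2 ^ n\<close> on \<open>\<epsilon>\<close>
  keeps it within 1/2 of the uniform density. Tolerance \<open>\<epsilon> / 4\<close> leaves the
  coefficients of \<open>\<phi>\<close> between \<open>\<epsilon> / 4\<close> and
  \<open>3 * \<epsilon> / 4\<close>.\<close>

lemma ex_density_bounded_sum:
  assumes n: "1 \<le> n" and k: "2 \<le> k" and \<epsilon>: "0 < \<epsilon>" "\<epsilon> \<le> 1 / 2 ^ n"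
  shows "\<exists>\<phi>. cube_density n \<phi> \<and>
    (\<forall>x\<in>cube n. \<phi> x \<noteq> 0 \<longrightarrow> \<bar>\<Sum>i=1..n. x i\<bar> \<le> 8 * real k * sqrt n) \<and>
    (\<forall>S\<subseteq>{1..n}. 1 \<le> card S \<and> card S \<le> k \<longrightarrow> \<bar>fourier_coeff n \<phi> S - \<epsilon> / 2\<bar> \<le> \<epsilon> / 4)"
proof -
  define q where "q = multilinear n (\<lambda>S. if S = {} then 1 else \<epsilon> / 2)"
  have coeff: "fourier_coeff n q S = (if S = {} then 1 else \<epsilon> / 2)" if "S \<subseteq> {1..n}" for S
  proof -
    have "fourier_coeff n q S = cube_expectation n (\<lambda>x. (\<Prod>i\<in>S. x i) * q x)"
      by (simp add: fourier_coeff_def mult.commute)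
    also have "\<dots>
        = (\<Sum>R\<in>Pow {1..n}. (if R = {} then 1 else \<epsilon> / 2) * fourier_coeff n (\<lambda>x. \<Prod>i\<in>S. x i) R)"
      unfolding q_def by (rule expectation_times_multilinear)
    also have "\<dots> = (\<Sum>R\<in>Pow {1..n}. if S = R then (if R = {} then 1 else \<epsilon> / 2) else 0)"
      using that by (intro sum.cong) (auto simp: fourier_coeff_def fourier_coeff_character)
    also have "\<dots> = (if S = {} then 1 else \<epsilon> / 2)" using that by simp
    finally show ?thesis .
  qed
  have q1: "cube_expectation n q = 1"
    using coeff[of "{}"] by (simp add: fourier_coeff_def)
  have near: "\<bar>q x - 1\<bar> \<le> 1 / 2" if x: "x \<in> cube n" for x
  proof -
    have "q x = 1 + (\<Sum>S\<in>Pow {1..n} - {{}}. \<epsilon> / 2 * (\<Prod>i\<in>S. x i))"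
      unfolding q_def multilinear_def by (subst sum.remove[of _ "{}"]) auto
    then have "\<bar>q x - 1\<bar> \<le> (\<Sum>S\<in>Pow {1..n} - {{}}. \<bar>\<epsilon> / 2 * (\<Prod>i\<in>S. x i)\<bar>)"
      using sum_abs[of "\<lambda>S. \<epsilon> / 2 * (\<Prod>i\<in>S. x i)"] by simp
    also have "\<dots> = (\<Sum>S\<in>Pow {1..n} - {{}}. \<epsilon> / 2)"
      using \<epsilon> abs_character[OF x] by (intro sum.cong) (auto simp: abs_mult)
    also have "\<dots> \<le> (\<Sum>S\<in>Pow {1..n}. \<epsilon> / 2)"
      using \<epsilon> by (intro sum_mono2) auto
    also have "\<dots> = 2 ^ n * \<epsilon> / 2" by (simp add: card_Pow)
    also have "\<dots> \<le> 1 / 2" using \<epsilon> by (simp add: field_simps)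
    finally show ?thesis .
  qed
  define A where "A = {x :: nat \<Rightarrow> real. \<bar>\<Sum>i=1..n. x i\<bar> \<le> 8 * real k * sqrt n}"
  have "cube_expectation n (\<lambda>x. if x \<in> A then 0 else 1) \<le> 6 / 256 ^ k"
    using cube_sum_tail[OF n, of k] unfolding A_def by simp
  also have "\<dots> < 9 / 256 / 9 ^ k"
  proof -
    \<comment> \<open>Cleared of denominators, the case \<open>k = 2\<close> reads 124416 < 9 *
      256^2, and larger \<open>k\<close> only helps. For \<open>k = 1\<close> the inequality
      fails.\<close>
    obtain j where j: "k = j + 2" using k by (metis le_add_diff_inverse2)
    have "(6::real) * 256 * 9 ^ k = 124416 * 9 ^ j" by (simp add: j)
    also have "\<dots> \<le> 124416 * 256 ^ j" by (intro mult_left_mono power_mono) auto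
    also have "\<dots> < 9 * 256 ^ k" by (simp add: j)
    finally show ?thesis by (simp add: field_simps)
  qed
  finally have A: "cube_expectation n (\<lambda>x. if x \<in> A then 0 else 1) < 9 / 256 / 9 ^ k" .
  have q: "1 / 2 \<le> q x" "q x \<le> 3 / 2" if "x \<in> cube n" for x
    using near[OF that] by linarith+
  have "0 < \<epsilon> / 4" using \<epsilon>(1) by simp
  from density_matching_low_degree[OF A q q1 this]
  obtain \<phi> where \<phi>: "cube_density n \<phi>" "\<forall>x\<in>cube n. \<phi> x \<noteq> 0 \<longrightarrow> x \<in> A"
    "\<forall>S\<subseteq>{1..n}. 1 \<le> card S \<and> card S \<le> k \<longrightarrow> \<bar>fourier_coeff n \<phi> S - fourier_coeff n q S\<bar> \<le> \<epsilon> / 4"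
    by blast
  have "\<bar>fourier_coeff n \<phi> S - \<epsilon> / 2\<bar> \<le> \<epsilon> / 4" if S: "S \<subseteq> {1..n}" "1 \<le> card S" "card S \<le> k" for S
  proof -
    have "S \<noteq> {}" using S(2) by auto
    then have "fourier_coeff n q S = \<epsilon> / 2" using coeff[OF S(1)] by simp
    then show ?thesis using \<phi>(3) S by metis
  qed
  with \<phi>(1,2) show ?thesis unfolding A_def by blast
qed

theorem theorem2:
  "\<exists>c::real. c > 0 \<and>
     (\<forall>n k :: nat. 1 \<le> n \<and> 1 \<le> k \<and> even k \<longrightarrow>
       (\<exists>\<epsilon>\<^sub>0::real. \<epsilon>\<^sub>0 > 0 \<and>
         (\<forall>\<epsilon>::real. 0 < \<epsilon> \<and> \<epsilon> \<le> \<epsilon>\<^sub>0 \<longrightarrow>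
           (\<exists>\<phi> \<delta>. cube_density n \<phi> \<and> eps_kwise_uniform n \<epsilon> k \<phi> \<and>
              \<delta> \<ge> (c / real k) ^ k * real n powr (real k / 2) * \<epsilon> \<and>
              (\<forall>\<psi>. cube_density n \<psi> \<and> kwise_uniform n k \<psi> \<longrightarrow> far_from n \<delta> \<phi> \<psi>)))))"
proof (rule exI[of _ "1 / 64"], intro conjI allI impI)
  fix n k :: nat
  assume "1 \<le> n \<and> 1 \<le> k \<and> even k"
  then have n: "1 \<le> n" and k: "2 \<le> k" "even k" by (auto elim: evenE)
  show "\<exists>\<epsilon>\<^sub>0::real. \<epsilon>\<^sub>0 > 0 \<and>
         (\<forall>\<epsilon>::real. 0 < \<epsilon> \<and> \<epsilon> \<le> \<epsilon>\<^sub>0 \<longrightarrow>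
           (\<exists>\<phi> \<delta>. cube_density n \<phi> \<and> eps_kwise_uniform n \<epsilon> k \<phi> \<and>
              \<delta> \<ge> (1 / 64 / real k) ^ k * real n powr (real k / 2) * \<epsilon> \<and>
              (\<forall>\<psi>. cube_density n \<psi> \<and> kwise_uniform n k \<psi> \<longrightarrow> far_from n \<delta> \<phi> \<psi>)))"
  proof (rule exI[of _ "1 / 2 ^ n"], intro conjI allI impI)
    fix \<epsilon> :: real
    assume "0 < \<epsilon> \<and> \<epsilon> \<le> 1 / 2 ^ n"
    then have \<epsilon>: "0 < \<epsilon>" "\<epsilon> \<le> 1 / 2 ^ n" by auto
    obtain \<phi> where \<phi>: "cube_density n \<phi>"
      and supp: "\<And>x. x \<in> cube n \<Longrightarrow> \<phi> x \<noteq> 0 \<Longrightarrow> \<bar>\<Sum>i=1..n. x i\<bar> \<le> 8 * real k * sqrt n"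
      and coeff: "\<And>S. S \<subseteq> {1..n} \<Longrightarrow> 1 \<le> card S \<Longrightarrow> card S \<le> k \<Longrightarrow> \<bar>fourier_coeff n \<phi> S - \<epsilon> / 2\<bar> \<le> \<epsilon> / 4"
      using ex_density_bounded_sum[OF n k(1) \<epsilon>] by blast
    define \<delta> where "\<delta> = (1 / 64 / real k) ^ k * real n powr (real k / 2) * \<epsilon>"
    define b where "b = sqrt n"
    have b: "1 \<le> b" "real n = b\<^sup>2" unfolding b_def using n by auto
    have powr: "real n powr (real k / 2) = b ^ k"
    proof -
      have "real n powr (real k / 2) = (real n powr (1 / 2)) powr real k" by (simp add: powr_powr)
      also have "real n powr (1 / 2) = b" unfolding b_def by (simp add: powr_half_sqrt)
      finally show ?thesis using b(1) by (simp add: powr_realpow)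
    qed
    have "\<bar>fourier_coeff n \<phi> S\<bar> \<le> \<epsilon>" if "S \<subseteq> {1..n}" "1 \<le> card S" "card S \<le> k" for S
      using coeff[OF that] \<epsilon> by linarith
    then have "eps_kwise_uniform n \<epsilon> k \<phi>" unfolding eps_kwise_uniform_def by blast
    moreover have "far_from n \<delta> \<phi> \<psi>" if \<psi>: "cube_density n \<psi>" "kwise_uniform n k \<psi>" for \<psi>
    proof -
      \<comment> \<open>A bound for the test function on the support of \<open>\<phi>\<close>: the
        sum is at most \<open>8 * real k * b\<close>, and \<open>1 \<le> real k * b\<close> absorbs
        the shift by 1.\<close>
      define M where "M = (16 * real k * b) ^ k"
      have M: "0 < M" unfolding M_def using k b by simp
      have "\<epsilon> / 4 * real n ^ k / 2
          \<le> cube_expectation n (\<lambda>x. (\<phi> x - \<psi> x) * (1 + (\<Sum>i=1..n. x i)) ^ k)"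
      proof (rule expectation_gap[OF \<phi> \<psi> n k])
        show "\<epsilon> / 4 \<le> fourier_coeff n \<phi> S" if "S \<subseteq> {1..n}" "1 \<le> card S" "card S \<le> k" for S
          using coeff[OF that] by linarith
      qed (use \<epsilon> in simp)
      also have "\<dots> \<le> M * tv_dist n \<phi> \<psi>"
      proof (rule expectation_gap_le_tv_dist[OF \<phi> \<psi>(1)])
        show "0 \<le> (1 + (\<Sum>i=1..n. x i)) ^ k" for x :: "nat \<Rightarrow> real"
          using k(2) by (rule zero_le_even_power)
        show "(1 + (\<Sum>i=1..n. x i)) ^ k \<le> M" if "x \<in> cube n" "\<phi> x \<noteq> 0" for x
        proof -
          have "1 * 1 \<le> real k * b" using k b by (intro mult_mono) auto
          then have "\<bar>1 + (\<Sum>i=1..n. x i)\<bar> \<le> 16 * real k * b"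
            using supp[OF that] unfolding b_def by linarith
          then have "\<bar>1 + (\<Sum>i=1..n. x i)\<bar> ^ k \<le> M"
            unfolding M_def by (intro power_mono) auto
          then show ?thesis using k(2) by (simp only: power_even_abs)
        qed
      qed (use M in simp)
      finally have gap: "\<epsilon> * real n ^ k \<le> 8 * (M * tv_dist n \<phi> \<psi>)" by simp
      \<comment> \<open>Here 64 = 16 * 4: the 16 cancels against \<open>M\<close>, and the spare
        \<open>4 ^ k\<close>, at least 16, outweighs the factor 8 in \<open>gap\<close>. The
        distance is thus at least \<open>2 * \<delta>\<close>, which gives the strict
        inequality.\<close>
      have "M * \<delta> * 4 ^ k = \<epsilon> * real n ^ k"
      proof -
        have "16 * real k * b * (1 / 64 / real k) * b * 4 = real n"
          using k b(2) by (simp add: power2_eq_square)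
        then have "(16 * real k * b * (1 / 64 / real k) * b * 4) ^ k = real n ^ k" by simp
        then show ?thesis
          unfolding M_def \<delta>_def powr power_mult_distrib by (simp add: mult_ac)
      qed
      moreover have "0 < M * \<delta>" using M \<epsilon> k n unfolding \<delta>_def by simp
      moreover have "M * \<delta> * 16 \<le> M * \<delta> * 4 ^ k"
        using power_increasing[OF k(1), of "4::real"] \<open>0 < M * \<delta>\<close> by (intro mult_left_mono) auto
      ultimately have "16 * (M * \<delta>) \<le> 8 * (M * tv_dist n \<phi> \<psi>)"
        using gap by linarith
      with \<open>0 < M * \<delta>\<close> have "M * \<delta> < M * tv_dist n \<phi> \<psi>" by linarith
      then show ?thesis using M unfolding far_from_def by simp
    qed
    ultimately show "\<exists>\<phi> \<delta>. cube_density n \<phi> \<and> eps_kwise_uniform n \<epsilon> k \<phi> \<and>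
              \<delta> \<ge> (1 / 64 / real k) ^ k * real n powr (real k / 2) * \<epsilon> \<and>
              (\<forall>\<psi>. cube_density n \<psi> \<and> kwise_uniform n k \<psi> \<longrightarrow> far_from n \<delta> \<phi> \<psi>)"
      using \<phi> by (intro exI[of _ \<phi>] exI[of _ \<delta>]) (auto simp: \<delta>_def)
  qed simp
qed simp

end
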